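(* Consider a minimization game $G^{\min}(u)$ with respect to $u\in\mathbb{R}^m$, with master problem $(P^{\min}(u))$ and dual function $\mu$. Let $x^*\in X$ and $\lambda^*\in\mathbb{R}^m_+$. Then: 1. $u$ is enforceable via $(x^*,\lambda^* )$ if and only if $(x^*,\lambda^* )$ has zero duality gap for $(P^{\min}(u))$ and $\ell_j(x^* )=u_j$ for all $j\in E$. 2. $u$ is weakly enforceable via $(x^*,\lambda^* )$ with market clearing prices $\lambda^*$ if and only if $(x^*,\lambda^* )$ has zero duality gap for $(P^{\min}(u))$. 3. $u$ is uniquely enforceable via $(x^*,\lambda^* )$ if and only if $(x^*,\lambda^* )$ has zero duality gap for $(P^{\min}(u))$ and $x^*$ is the unique optimal solution of $(P^{\min}(u))$ satisfying $\ell(x)\le u$ with equality (i.e. $\ell(x^* )=u$, and no other optimal solution $x$ of $(P^{\min}(u))$ satisfies $\ell(x)=u$).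
   Context: Setting. $E=\{1,\dots,m\}$ and $N=\{1,\dots,n\}$ are finite nonempty sets (resources, players). For $i\in N$, $X_i\subset\mathbb{R}^m$ is a nonempty strategy set, $X=\prod_{i\in N}X_i$, and $g_i:\mathbb{R}^m\to\mathbb{R}^m$ is a function with components $g_{ij}$. The load is $\ell(x)=\sum_{i\in N}g_i(x_i)\in\mathbb{R}^m$ for $x\in X$. In the game $G^{\min}(u)$ with parameter $u\in\mathbb{R}^m$, player $i$ has a cost function $x_i\mapsto\pi_i(u,x_i)\in\mathbb{R}$ on $X_i$. No further assumptions (such as convexity) are made on $X_i,\pi_i,g_i$. Enforceability. $u$ is enforceable via $(x^*,\lambda^* )\in X\times\mathbb{R}^m_+$ if (a) $\ell(x^* )=u$ and (b) for all $i\in N$, $x_i^*\in\arg\min_{x_i\in X_i}\{\pi_i(u,x_i)+(\lambda^* )^\intercal g_i(x_i)\}$. $u$ is weakly enforceable with market clearing prices via $(x^*,\lambda^* )$ if (b) holds, $\ell(x^* )\le u$ componentwise, and $\ell_j(x^* )<u_j$ implies $\lambda^*_j=0$ for every $j\in E$. $u$ is uniquely enforceable via $(x^*,\lambda^* )$ if, for this $\lambda^*$, $x^*$ is the unique element of $X$ satisfying (a) and (b). Master problem. $(P^{\min}(u))$: minimize $\pi(x):=\sum_{i\in N}\pi_i(u,x_i)$ subject to $\ell_j(x)\le u_j$ for $j\in E$ and $x\in X$; it is assumed that a global minimum exists. The Lagrangian dual function is $\mu(\lambda)=\inf_{x\in X}\{\pi(x)+\lambda^\intercal(\ell(x)-u)\}\in\mathbb{R}\cup\{-\infty\}$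 for $\lambda\in\mathbb{R}^m_+$. The pair $(x^*,\lambda^* )$ has zero duality gap (is primal-dual optimal) if $x^*$ is feasible for $(P^{\min}(u))$ and $\pi(x^* )=\mu(\lambda^* )$. *)

theory Defs
  imports "HOL-Analysis.Analysis"
begin

text \<open>
  Resources are the elements of a finite type \<open>'m\<close>, players those of a finite type \<open>'n\<close>.
  Throughout, \<open>X i\<close> is the strategy set of player \<open>i\<close>, \<open>g i\<close> the map sending a strategy of \<open>i\<close>
  to its contribution to the load, and \<open>\<pi> i u\<close> the cost function of \<open>i\<close> in the game with
  parameter \<open>u\<close>. Only the values of \<open>\<pi> i u\<close> on \<open>X i\<close> matter. Prices are written \<open>p\<close>.
\<close>

definition profiles :: "('n::finite \<Rightarrow> (real^'m) set) \<Rightarrow> ('n \<Rightarrow> real^'m) set" where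
  "profiles X = Pi\<^sub>E UNIV X"

definition nonneg_prices :: "(real^'m) set" where
  "nonneg_prices = {p. \<forall>j. 0 \<le> p $ j}"

definition load :: "('n::finite \<Rightarrow> real^'m \<Rightarrow> real^'m) \<Rightarrow> ('n \<Rightarrow> real^'m) \<Rightarrow> real^'m" where
  "load g x = (\<Sum>i\<in>UNIV. g i (x i))"

definition player_optimal ::
  "('n::finite \<Rightarrow> (real^'m) set) \<Rightarrow> ('n \<Rightarrow> real^'m \<Rightarrow> real^'m) \<Rightarrow> ('n \<Rightarrow> real^'m \<Rightarrow> real^'m \<Rightarrow> real)
    \<Rightarrow> real^'m \<Rightarrow> ('n \<Rightarrow> real^'m) \<Rightarrow> real^'m \<Rightarrow> bool" where
  "player_optimal X g \<pi> u x p \<longleftrightarrow>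
    (\<forall>i. is_arg_min (\<lambda>y. \<pi> i u y + p \<bullet> g i y) (\<lambda>y. y \<in> X i) (x i))"

definition enforceable ::
  "('n::finite \<Rightarrow> (real^'m) set) \<Rightarrow> ('n \<Rightarrow> real^'m \<Rightarrow> real^'m) \<Rightarrow> ('n \<Rightarrow> real^'m \<Rightarrow> real^'m \<Rightarrow> real)
    \<Rightarrow> real^'m \<Rightarrow> ('n \<Rightarrow> real^'m) \<Rightarrow> real^'m \<Rightarrow> bool" where
  "enforceable X g \<pi> u x p \<longleftrightarrow>
    x \<in> profiles X \<and> p \<in> nonneg_prices \<and> load g x = u \<and> player_optimal X g \<pi> u x p"

definition weakly_enforceable ::
  "('n::finite \<Rightarrow> (real^'m) set) \<Rightarrow> ('n \<Rightarrow> real^'m \<Rightarrow> real^'m) \<Rightarrow> ('n \<Rightarrow> real^'m \<Rightarrow> real^'m \<Rightarrow> real)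
    \<Rightarrow> real^'m \<Rightarrow> ('n \<Rightarrow> real^'m) \<Rightarrow> real^'m \<Rightarrow> bool" where
  "weakly_enforceable X g \<pi> u x p \<longleftrightarrow>
    x \<in> profiles X \<and> p \<in> nonneg_prices \<and> player_optimal X g \<pi> u x p \<and>
    (\<forall>j. load g x $ j \<le> u $ j) \<and> (\<forall>j. load g x $ j < u $ j \<longrightarrow> p $ j = 0)"

text \<open>Uniqueness concerns the profile only; the price vector is held fixed.\<close>

definition uniquely_enforceable ::
  "('n::finite \<Rightarrow> (real^'m) set) \<Rightarrow> ('n \<Rightarrow> real^'m \<Rightarrow> real^'m) \<Rightarrow> ('n \<Rightarrow> real^'m \<Rightarrow> real^'m \<Rightarrow> real)
    \<Rightarrow> real^'m \<Rightarrow> ('n \<Rightarrow> real^'m) \<Rightarrow> real^'m \<Rightarrow> bool" where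
  "uniquely_enforceable X g \<pi> u x p \<longleftrightarrow>
    enforceable X g \<pi> u x p \<and> (\<forall>y. enforceable X g \<pi> u y p \<longrightarrow> y = x)"

definition total_cost ::
  "('n::finite \<Rightarrow> real^'m \<Rightarrow> real^'m \<Rightarrow> real) \<Rightarrow> real^'m \<Rightarrow> ('n \<Rightarrow> real^'m) \<Rightarrow> real" where
  "total_cost \<pi> u x = (\<Sum>i\<in>UNIV. \<pi> i u (x i))"

definition master_feasible ::
  "('n::finite \<Rightarrow> (real^'m) set) \<Rightarrow> ('n \<Rightarrow> real^'m \<Rightarrow> real^'m) \<Rightarrow> real^'m \<Rightarrow> ('n \<Rightarrow> real^'m) \<Rightarrow> bool" where
  "master_feasible X g u x \<longleftrightarrow> x \<in> profiles X \<and> (\<forall>j. load g x $ j \<le> u $ j)"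

definition master_optimal ::
  "('n::finite \<Rightarrow> (real^'m) set) \<Rightarrow> ('n \<Rightarrow> real^'m \<Rightarrow> real^'m) \<Rightarrow> ('n \<Rightarrow> real^'m \<Rightarrow> real^'m \<Rightarrow> real)
    \<Rightarrow> real^'m \<Rightarrow> ('n \<Rightarrow> real^'m) \<Rightarrow> bool" where
  "master_optimal X g \<pi> u x \<longleftrightarrow> is_arg_min (total_cost \<pi> u) (master_feasible X g u) x"

text \<open>The infimum is taken in \<open>ereal\<close>, so an unbounded Lagrangian gives the value \<open>-\<infinity>\<close>.\<close>

definition dual_function ::
  "('n::finite \<Rightarrow> (real^'m) set) \<Rightarrow> ('n \<Rightarrow> real^'m \<Rightarrow> real^'m) \<Rightarrow> ('n \<Rightarrow> real^'m \<Rightarrow> real^'m \<Rightarrow> real)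
    \<Rightarrow> real^'m \<Rightarrow> real^'m \<Rightarrow> ereal" where
  "dual_function X g \<pi> u p =
    (INF x\<in>profiles X. ereal (total_cost \<pi> u x + p \<bullet> (load g x - u)))"

definition zero_duality_gap ::
  "('n::finite \<Rightarrow> (real^'m) set) \<Rightarrow> ('n \<Rightarrow> real^'m \<Rightarrow> real^'m) \<Rightarrow> ('n \<Rightarrow> real^'m \<Rightarrow> real^'m \<Rightarrow> real)
    \<Rightarrow> real^'m \<Rightarrow> ('n \<Rightarrow> real^'m) \<Rightarrow> real^'m \<Rightarrow> bool" where
  "zero_duality_gap X g \<pi> u x p \<longleftrightarrow>
    p \<in> nonneg_prices \<and> master_feasible X g u x \<and>
    ereal (total_cost \<pi> u x) = dual_function X g \<pi> u p"

end

theory Submission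
  imports Defs
begin

text \<open>
  Up to the constant \<open>- p \<bullet> u\<close>, the Lagrangian is the sum over the players of their priced costs,
  each depending on that player's strategy only. Since \<open>X\<close> is a product, a profile minimizes the
  Lagrangian iff every player optimizes individually. On the feasible set the price term of the
  Lagrangian is nonpositive, so zero duality gap means exactly that the profile minimizes the
  Lagrangian and complementary slackness holds.
\<close>

definition lagrangian ::
  "('n::finite \<Rightarrow> real^'m \<Rightarrow> real^'m) \<Rightarrow> ('n \<Rightarrow> real^'m \<Rightarrow> real^'m \<Rightarrow> real)
    \<Rightarrow> real^'m \<Rightarrow> real^'m \<Rightarrow> ('n \<Rightarrow> real^'m) \<Rightarrow> real" where
  "lagrangian g \<pi> u p x = total_cost \<pi> u x + p \<bullet> (load g x - u)"

lemma lagrangian_eq_sum: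
  "lagrangian g \<pi> u p x = (\<Sum>i\<in>UNIV. \<pi> i u (x i) + p \<bullet> g i (x i)) - p \<bullet> u"
  by (simp add: lagrangian_def total_cost_def load_def inner_diff_right inner_sum_right sum.distrib)

text \<open>A product set allows each coordinate to be changed independently: unilateral deviations
  give one direction, summing the coordinatewise inequalities gives the other.\<close>

lemma is_arg_min_sum_PiE_iff:
  fixes f :: "'i::finite \<Rightarrow> 'a \<Rightarrow> real"
  shows "is_arg_min (\<lambda>x. \<Sum>i\<in>UNIV. f i (x i)) (\<lambda>x. x \<in> Pi\<^sub>E UNIV X) x \<longleftrightarrow>
    (\<forall>i. is_arg_min (f i) (\<lambda>y. y \<in> X i) (x i))"
proof
  assume min: "is_arg_min (\<lambda>x. \<Sum>i\<in>UNIV. f i (x i)) (\<lambda>x. x \<in> Pi\<^sub>E UNIV X) x"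
  then have x: "x i \<in> X i" for i
    by (auto simp: is_arg_min_def)
  have "f i (x i) \<le> f i y" if "y \<in> X i" for i y
  proof -
    \<comment> \<open>The deviation \<open>x(i := y)\<close> stays in the product and alters only
      summand \<open>i\<close>, so all other summands cancel.\<close>
    have "(\<Sum>k\<in>UNIV. f k (x k)) \<le> (\<Sum>k\<in>UNIV. f k ((x(i := y)) k))"
      using min x that by (auto simp: is_arg_min_linorder PiE_iff)
    also have "(\<Sum>k\<in>UNIV. f k ((x(i := y)) k)) = f i y + (\<Sum>k\<in>UNIV - {i}. f k (x k))"
      by (simp add: sum.remove[of UNIV i])
    finally show ?thesis
      by (simp add: sum.remove[of UNIV i])
  qed
  with x show "\<forall>i. is_arg_min (f i) (\<lambda>y. y \<in> X i) (x i)"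
    by (simp add: is_arg_min_linorder)
next
  assume "\<forall>i. is_arg_min (f i) (\<lambda>y. y \<in> X i) (x i)"
  then show "is_arg_min (\<lambda>x. \<Sum>i\<in>UNIV. f i (x i)) (\<lambda>x. x \<in> Pi\<^sub>E UNIV X) x"
    by (auto simp: is_arg_min_linorder PiE_iff intro!: sum_mono)
qed

lemma player_optimal_iff_lagrangian_min:
  "player_optimal X g \<pi> u x p \<longleftrightarrow>
    is_arg_min (lagrangian g \<pi> u p) (\<lambda>y. y \<in> profiles X) x"
proof -
  have "is_arg_min (lagrangian g \<pi> u p) (\<lambda>y. y \<in> profiles X) x \<longleftrightarrow>
      is_arg_min (\<lambda>x. \<Sum>i\<in>UNIV. \<pi> i u (x i) + p \<bullet> g i (x i)) (\<lambda>y. y \<in> profiles X) x"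
    by (simp add: is_arg_min_linorder lagrangian_eq_sum)
  then show ?thesis
    unfolding player_optimal_def profiles_def
    using is_arg_min_sum_PiE_iff[of "\<lambda>i y. \<pi> i u y + p \<bullet> g i y" X x] by simp
qed

lemma dual_function_eq: "dual_function X g \<pi> u p = (INF x\<in>profiles X. ereal (lagrangian g \<pi> u p x))"
  by (simp add: dual_function_def lagrangian_def)

text \<open>Turns comparisons with the extended-real dual value into real inequalities, so that no
  case distinction on its finiteness arises.\<close>

lemma le_dual_function_iff:
  "ereal c \<le> dual_function X g \<pi> u p \<longleftrightarrow> (\<forall>y\<in>profiles X. c \<le> lagrangian g \<pi> u p y)"
  by (simp add: dual_function_eq le_INF_iff)

lemma dual_function_le_lagrangian:
  "x \<in> profiles X \<Longrightarrow> dual_function X g \<pi> u p \<le> ereal (lagrangian g \<pi> u p x)"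
  unfolding dual_function_eq by (rule INF_lower)

lemma lagrangian_le_total_cost:
  assumes "p \<in> nonneg_prices" "master_feasible X g u x"
  shows "lagrangian g \<pi> u p x \<le> total_cost \<pi> u x"
proof -
  have "p \<bullet> (load g x - u) \<le> 0"
    unfolding inner_vec_def
    by (rule sum_nonpos)
      (use assms in \<open>auto simp: nonneg_prices_def master_feasible_def mult_nonneg_nonpos\<close>)
  then show ?thesis
    by (simp add: lagrangian_def)
qed

lemma complementary_slackness_iff:
  fixes p u v :: "real^'m::finite"
  assumes "p \<in> nonneg_prices" "\<And>j. v $ j \<le> u $ j"
  shows "p \<bullet> (v - u) = 0 \<longleftrightarrow> (\<forall>j. v $ j < u $ j \<longrightarrow> p $ j = 0)"
proof -
  \<comment> \<open>With the difference reversed, every term of the inner product is nonnegative, so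
    the sum vanishes only if each term does.\<close>
  have "p \<bullet> (u - v) = 0 \<longleftrightarrow> (\<forall>j. p $ j * (u $ j - v $ j) = 0)"
    unfolding inner_vec_def
    by (subst sum_nonneg_eq_0_iff) (use assms in \<open>auto simp: nonneg_prices_def\<close>)
  moreover have "p \<bullet> (v - u) = - (p \<bullet> (u - v))"
    by (simp add: inner_diff_right)
  moreover have "u $ j - v $ j = 0 \<longleftrightarrow> \<not> v $ j < u $ j" for j
    using assms(2)[of j] by linarith
  ultimately show ?thesis
    by auto
qed

lemma zero_duality_gap_iff:
  "zero_duality_gap X g \<pi> u x p \<longleftrightarrow>
    p \<in> nonneg_prices \<and> master_feasible X g u x \<and>
    player_optimal X g \<pi> u x p \<and> p \<bullet> (load g x - u) = 0"
proof (cases "p \<in> nonneg_prices \<and> master_feasible X g u x")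
  case True
  then have x: "x \<in> profiles X" and le: "lagrangian g \<pi> u p x \<le> total_cost \<pi> u x"
    by (auto simp: master_feasible_def intro: lagrangian_le_total_cost)
  \<comment> \<open>This is weak duality at \<open>x\<close>; a zero gap then amounts to the reverse
    inequality alone, that is, to a lower bound on the Lagrangian over all profiles.\<close>
  have ge: "ereal (total_cost \<pi> u x) \<ge> dual_function X g \<pi> u p"
    using dual_function_le_lagrangian[OF x] le by (meson ereal_less_eq(3) order_trans)
  have "ereal (total_cost \<pi> u x) = dual_function X g \<pi> u p \<longleftrightarrow>
      (\<forall>y\<in>profiles X. total_cost \<pi> u x \<le> lagrangian g \<pi> u p y)"
    using ge by (auto simp: le_dual_function_iff[symmetric])
  \<comment> \<open>Choosing \<open>y = x\<close> in the lower bound and combining with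
    \<open>le\<close> forces the Lagrangian at \<open>x\<close> to equal the cost.\<close>
  also have "\<dots> \<longleftrightarrow> (\<forall>y\<in>profiles X. lagrangian g \<pi> u p x \<le> lagrangian g \<pi> u p y) \<and>
      lagrangian g \<pi> u p x = total_cost \<pi> u x"
    using x le by (auto intro: antisym order_trans)
  finally show ?thesis
    using True x
    by (auto simp: zero_duality_gap_def player_optimal_iff_lagrangian_min is_arg_min_linorder
        lagrangian_def)
qed (auto simp: zero_duality_gap_def)

lemma weakly_enforceable_iff_zero_duality_gap:
  "weakly_enforceable X g \<pi> u x p \<longleftrightarrow> zero_duality_gap X g \<pi> u x p"
  using complementary_slackness_iff[of p "load g x" u]
  by (auto simp: weakly_enforceable_def zero_duality_gap_iff master_feasible_def)

lemma enforceable_iff_zero_duality_gap: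
  "enforceable X g \<pi> u x p \<longleftrightarrow> zero_duality_gap X g \<pi> u x p \<and> load g x = u"
  by (auto simp: enforceable_def zero_duality_gap_iff master_feasible_def)

text \<open>By weak duality the dual value at \<open>p\<close> bounds the cost of every feasible
  profile from below, and \<open>x\<close> attains this bound.\<close>

lemma zero_duality_gap_imp_master_optimal:
  assumes "zero_duality_gap X g \<pi> u x p"
  shows "master_optimal X g \<pi> u x"
proof -
  have "total_cost \<pi> u x \<le> total_cost \<pi> u y" if "master_feasible X g u y" for y
  proof -
    have "total_cost \<pi> u x \<le> lagrangian g \<pi> u p y"
      using assms that le_dual_function_iff[of "total_cost \<pi> u x" X g \<pi> u p]
      by (auto simp: zero_duality_gap_def master_feasible_def)
    also have "\<dots> \<le> total_cost \<pi> u y"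
      using assms that by (auto simp: zero_duality_gap_def intro: lagrangian_le_total_cost)
    finally show ?thesis .
  qed
  with assms show ?thesis
    by (auto simp: master_optimal_def is_arg_min_linorder zero_duality_gap_def)
qed

text \<open>The dual value depends on \<open>p\<close> but not on the profile, and all optimal
  solutions have the same cost. Hence a price vector that certifies one of them certifies
  all.\<close>

lemma zero_duality_gap_master_optimal:
  assumes "zero_duality_gap X g \<pi> u x p" "master_optimal X g \<pi> u y"
  shows "zero_duality_gap X g \<pi> u y p"
proof -
  have "total_cost \<pi> u x = total_cost \<pi> u y"
    using zero_duality_gap_imp_master_optimal[OF assms(1)] assms(2)
    by (auto simp: master_optimal_def is_arg_min_linorder intro: antisym)
  with assms show ?thesis
    by (auto simp: zero_duality_gap_def master_optimal_def is_arg_min_def)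
qed

theorem theorem2p3:
  fixes X :: "'n::finite \<Rightarrow> (real^'m::finite) set"
    and g :: "'n \<Rightarrow> real^'m \<Rightarrow> real^'m"
    and \<pi> :: "'n \<Rightarrow> real^'m \<Rightarrow> real^'m \<Rightarrow> real"
    and u p :: "real^'m"
    and x :: "'n \<Rightarrow> real^'m"
  assumes "\<And>i. X i \<noteq> {}"
    and "\<exists>y. master_optimal X g \<pi> u y"
    and "x \<in> profiles X"
    and "p \<in> nonneg_prices"
  shows "(enforceable X g \<pi> u x p \<longleftrightarrow>
            zero_duality_gap X g \<pi> u x p \<and> (\<forall>j. load g x $ j = u $ j)) \<and>
         (weakly_enforceable X g \<pi> u x p \<longleftrightarrow> zero_duality_gap X g \<pi> u x p) \<and>
         (uniquely_enforceable X g \<pi> u x p \<longleftrightarrow>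
            zero_duality_gap X g \<pi> u x p \<and>
            master_optimal X g \<pi> u x \<and> load g x = u \<and>
            (\<forall>y. master_optimal X g \<pi> u y \<and> load g y = u \<longrightarrow> y = x))"
proof (intro conjI)
  show "enforceable X g \<pi> u x p \<longleftrightarrow>
      zero_duality_gap X g \<pi> u x p \<and> (\<forall>j. load g x $ j = u $ j)"
    by (simp add: enforceable_iff_zero_duality_gap vec_eq_iff)
  show "weakly_enforceable X g \<pi> u x p \<longleftrightarrow> zero_duality_gap X g \<pi> u x p"
    by (rule weakly_enforceable_iff_zero_duality_gap)
  show "uniquely_enforceable X g \<pi> u x p \<longleftrightarrow>
      zero_duality_gap X g \<pi> u x p \<and>
      master_optimal X g \<pi> u x \<and> load g x = u \<and>
      (\<forall>y. master_optimal X g \<pi> u y \<and> load g y = u \<longrightarrow> y = x)"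
    \<comment> \<open>Once \<open>x\<close> has zero gap with \<open>p\<close>, the profiles having
      zero gap with this \<open>p\<close> are exactly the optimal solutions of the master problem,
      so both uniqueness conditions range over the same profiles of load \<open>u\<close>.\<close>
    unfolding uniquely_enforceable_def enforceable_iff_zero_duality_gap
    using zero_duality_gap_imp_master_optimal zero_duality_gap_master_optimal by blast
qed

end
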